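(* Let $G$ be a finite group. Then we have the following: (1) $diam(\mathcal{RP}(G))=1$ if $G\cong\mathbb Z_2$, and $diam(\mathcal{RP}(G))=2$ otherwise. (2) $$diam(\mathcal{RP}^*(G))=\begin{cases}2,&\text{if }G\cong\mathbb Z_{p^n}\text{ for some prime }p\text{ and some }n\ge 2;\\ \infty,&\text{if }G\cong\mathbb Z_p\text{ for some prime }p;\\ diam(\mathcal P^*(G)),&\text{otherwise.}\end{cases}$$
   Context: For a group $G$ with identity $e$, the reduced power graph $\mathcal{RP}(G)$ is the simple graph with vertex set $G$ in which $u,v$ are adjacent if and only if $\langle v\rangle\subset\langle u\rangle$ or $\langle u\rangle\subset\langle v\rangle$, where $\subset$ means proper inclusion; the proper reduced power graph $\mathcal{RP}^*(G)$ is its subgraph induced on $G\setminus\{e\}$. The proper power graph $\mathcal P^*(G)$ is the simple graph with vertex set $G\setminus\{e\}$ in which distinct $u,v$ are adjacent if and only if $\langle v\rangle\subseteq\langle u\rangle$ or $\langle u\rangle\subseteq\langle v\rangle$. The diameter $diam(\Gamma)$ of a connected graph $\Gamma$ is the maximum of the distances $d(u,v)$ over vertices $u,v$ of $\Gamma$, where $d(u,v)$ is the length of a shortest $u$–$v$ path; if $\Gamma$ is disconnected, $diam(\Gamma)=\infty$.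
   Formalization: Part (1) is stated only for nontrivial G, since RP of the trivial group is a single vertex of diameter 0, not 2; part (2) is stated only for G not isomorphic to Z_2, since RP*(Z_2) is a single vertex of diameter 0, not infinity. *)

theory Defs
  imports
    "HOL-Algebra.Elementary_Groups"
    "HOL-Algebra.Generated_Groups"
    "HOL-Computational_Algebra.Primes"
    "HOL-Library.Extended_Nat"
    "Graph_Theory.Digraph_Component"
begin

text \<open>
  As in Graph_Theory, a simple graph is a loop-free symmetric digraph without
  parallel arcs; an edge is represented by the two arcs \<open>(u, v)\<close> and \<open>(v, u)\<close>.
\<close>

text \<open>The distance is \<open>\<infinity>\<close> if there is no path.\<close>

definition graph_dist :: "('a, 'b) pre_digraph \<Rightarrow> 'a \<Rightarrow> 'a \<Rightarrow> enat" where
  "graph_dist H u v = (INF p \<in> {p. pre_digraph.apath H u p v}. enat (length p))"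

text \<open>
  For a nonempty finite vertex set the supremum is a maximum. The one-vertex graph
  is connected with diameter 0; the empty graph is not connected in the sense
  of Graph_Theory, hence has diameter \<open>\<infinity>\<close>.
\<close>

definition graph_diam :: "('a, 'b) pre_digraph \<Rightarrow> enat" where
  "graph_diam H =
     (if Digraph_Component.connected H
      then SUP u \<in> verts H. SUP v \<in> verts H. graph_dist H u v
      else \<infinity>)"

definition reduced_power_graph ::
    "('a, 'm) monoid_scheme \<Rightarrow> ('a, 'a \<times> 'a) pre_digraph" where
  "reduced_power_graph G = with_proj
     \<lparr>pverts = carrier G,
      parcs = {(u, v). u \<in> carrier G \<and> v \<in> carrier G \<and>
        (generate G {v} \<subset> generate G {u} \<or> generate G {u} \<subset> generate G {v})}\<rparr>"

definition proper_reduced_power_graph ::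
    "('a, 'm) monoid_scheme \<Rightarrow> ('a, 'a \<times> 'a) pre_digraph" where
  "proper_reduced_power_graph G =
     induce_subgraph (reduced_power_graph G) (carrier G - {\<one>\<^bsub>G\<^esub>})"

definition proper_power_graph ::
    "('a, 'm) monoid_scheme \<Rightarrow> ('a, 'a \<times> 'a) pre_digraph" where
  "proper_power_graph G = with_proj
     \<lparr>pverts = carrier G - {\<one>\<^bsub>G\<^esub>},
      parcs = {(u, v). u \<in> carrier G - {\<one>\<^bsub>G\<^esub>} \<and> v \<in> carrier G - {\<one>\<^bsub>G\<^esub>} \<and> u \<noteq> v \<and>
        (generate G {v} \<subseteq> generate G {u} \<or> generate G {u} \<subseteq> generate G {v})}\<rparr>"

end

theory Submission
  imports Defs "HOL-Algebra.Multiplicative_Group"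
begin

text \<open>
  Both graphs compare the cyclic subgroups \<open>\<langle>x\<rangle>\<close> of the vertices \<open>x\<close>: the power graph joins
  distinct vertices with comparable subgroups, the reduced power graph only those with properly
  comparable ones.  Hence they differ just by the edges between \<^emph>\<open>twins\<close>, distinct
  vertices that generate the same subgroup.

  Twins can be interchanged in a walk, since a neighbour of one in the reduced graph is a neighbour
  of the other.  So every walk of the power graph becomes a walk of the reduced graph that is no
  longer, unless its ends generate the same subgroup (\<open>walk_avoiding_twins\<close>).  Twins that have
  any neighbour in the reduced graph are at distance 2 there.  If some two vertices are incomparable,
  the diameter of the power graph is at least 2, and connectedness provides twins with the
  neighbour they need; so the two diameters agree (\<open>graph_diam_strict_comparability_graph\<close>).

  If all elements of a nontrivial finite group \<open>G\<close> are comparable, then \<open>G\<close> is generated by an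
  element of maximal order, and \<open>G\<close> has no two subgroups of coprime orders greater than 1, so \<open>G\<close>
  is cyclic of prime power order (\<open>comparable_imp_cyclic_prime_power\<close>).  Such a group has to be
  treated separately.  In prime order, all non-identity elements generate \<open>G\<close>, so no two of them
  are adjacent in the reduced graph.  In composite order, a cyclic group has generators and
  non-identity non-generators, and each of the former is adjacent to each of the latter, whence the
  diameter is at most 2; it is not smaller because a generator differs from its inverse and is not
  adjacent to it.

  In the reduced power graph on all of \<open>G\<close>, the identity is adjacent to every other vertex,
  so the diameter is at most 2; it is 1 only if there are neither twins nor two distinct
  involutions, that is, for order 2.
\<close>

section \<open>Diameter and powers of the adjacency relation\<close>

lemma (in wf_digraph) relpow_arcs_ends_iff_awalk:
  assumes "u \<in> verts G"
  shows "(u, v) \<in> arcs_ends G ^^ n \<longleftrightarrow> (\<exists>p. awalk u p v \<and> length p = n)"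
  using assms
proof (induction n arbitrary: u)
  case 0
  then show ?case by (auto simp: awalk_Nil_iff)
next
  case (Suc n)
  show ?case
  proof
    assume "(u, v) \<in> arcs_ends G ^^ Suc n"
    then obtain w where uw: "(u, w) \<in> arcs_ends G" and wv: "(w, v) \<in> arcs_ends G ^^ n"
      by (blast dest: relpow_Suc_D2)
    from uw obtain e where e: "e \<in> arcs G" "tail G e = u" "head G e = w"
      by (auto simp: arcs_ends_def arc_to_ends_def)
    with wv obtain p where "awalk w p v" "length p = n"
      using Suc.IH[of w] by auto
    with e have "awalk u (e # p) v \<and> length (e # p) = Suc n"
      by (auto simp: awalk_Cons_iff)
    then show "\<exists>p. awalk u p v \<and> length p = Suc n" by blast
  next
    assume "\<exists>p. awalk u p v \<and> length p = Suc n"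
    then obtain e p where e: "e \<in> arcs G" "u = tail G e"
      and p: "awalk (head G e) p v" "length p = n"
      by (auto simp: length_Suc_conv awalk_Cons_iff)
    have "(u, head G e) \<in> arcs_ends G"
      using e by (auto simp: arcs_ends_def arc_to_ends_def)
    moreover have "(head G e, v) \<in> arcs_ends G ^^ n"
      using Suc.IH[of "head G e"] e p by auto
    ultimately show "(u, v) \<in> arcs_ends G ^^ Suc n" by (rule relpow_Suc_I2)
  qed
qed

lemma (in wf_digraph) awalk_imp_shorter_apath:
  assumes "awalk u p v"
  shows "\<exists>q. apath u q v \<and> length q \<le> length p"
  using assms
proof (induction rule: awalk_to_apath_induct)
  case (path p)
  then show ?case by (auto simp: apath_def)
next
  case (decomp p q r s)
  have "p = q @ r @ s"
    using awalk_cyc_decompE[OF decomp(2,1,3)] by blast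
  then have "length (q @ s) \<le> length p" by simp
  with decomp(4) show ?case by (meson order_trans)
qed

lemma (in wf_digraph) graph_dist_le_iff:
  assumes "u \<in> verts G"
  shows "graph_dist G u v \<le> enat k \<longleftrightarrow> (\<exists>n\<le>k. (u, v) \<in> arcs_ends G ^^ n)"
proof
  assume le: "graph_dist G u v \<le> enat k"
  let ?L = "(\<lambda>p. enat (length p)) ` {p. apath u p v}"
  have "?L \<noteq> {}"
  proof
    assume "?L = {}"
    then have "graph_dist G u v = \<infinity>" by (simp add: graph_dist_def top_enat_def)
    with le show False by simp
  qed
  then have "Inf ?L \<in> ?L"
    unfolding Inf_enat_def by (auto intro: LeastI)
  then obtain p where "apath u p v" "graph_dist G u v = enat (length p)"
    unfolding graph_dist_def by blast
  with le show "\<exists>n\<le>k. (u, v) \<in> arcs_ends G ^^ n"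
    using relpow_arcs_ends_iff_awalk[OF assms] by (auto intro: awalkI_apath)
next
  assume "\<exists>n\<le>k. (u, v) \<in> arcs_ends G ^^ n"
  then obtain p where p: "awalk u p v" "length p \<le> k"
    using relpow_arcs_ends_iff_awalk[OF assms] by auto
  then obtain q where q: "apath u q v" "length q \<le> length p"
    using awalk_imp_shorter_apath by blast
  have "graph_dist G u v \<le> enat (length q)"
    unfolding graph_dist_def using q by (intro INF_lower) simp
  also have "\<dots> \<le> enat k" using p q by simp
  finally show "graph_dist G u v \<le> enat k" .
qed

text \<open>
  Connectedness need not be mentioned: a finite diameter implies it, and walks between all pairs
  of vertices of a nonempty graph give it.
\<close>

lemma (in wf_digraph) graph_diam_le_iff:
  "graph_diam G \<le> enat k \<longleftrightarrow>
     verts G \<noteq> {} \<and> (\<forall>u\<in>verts G. \<forall>v\<in>verts G. \<exists>n\<le>k. (u, v) \<in> arcs_ends G ^^ n)"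
proof
  assume le: "graph_diam G \<le> enat k"
  then have con: "Digraph_Component.connected G"
    by (auto simp: graph_diam_def split: if_splits)
  with le have "(SUP u\<in>verts G. SUP v\<in>verts G. graph_dist G u v) \<le> enat k"
    by (simp add: graph_diam_def)
  then have "\<forall>u\<in>verts G. \<forall>v\<in>verts G. graph_dist G u v \<le> enat k"
    by (simp add: SUP_le_iff)
  with con show "verts G \<noteq> {} \<and>
      (\<forall>u\<in>verts G. \<forall>v\<in>verts G. \<exists>n\<le>k. (u, v) \<in> arcs_ends G ^^ n)"
    by (auto simp: graph_dist_le_iff connected_conv)
next
  assume walks: "verts G \<noteq> {} \<and>
      (\<forall>u\<in>verts G. \<forall>v\<in>verts G. \<exists>n\<le>k. (u, v) \<in> arcs_ends G ^^ n)"
  have "u \<rightarrow>\<^sup>*\<^bsub>mk_symmetric G\<^esub> v" if uv: "u \<in> verts G" "v \<in> verts G" for u v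
  proof -
    obtain p where "awalk u p v"
      using walks uv relpow_arcs_ends_iff_awalk[OF uv(1)] by blast
    then have "u \<rightarrow>\<^sup>* v" by (rule reachable_awalkI)
    then show ?thesis by (rule reachable_mk_symmetricI)
  qed
  with walks have "Digraph_Component.connected G"
    unfolding connected_def by (intro strongly_connectedI) auto
  with walks show "graph_diam G \<le> enat k"
    by (auto simp: graph_diam_def SUP_le_iff graph_dist_le_iff)
qed

lemma (in wf_digraph) not_graph_diam_le:
  assumes "u \<in> verts G" "v \<in> verts G" "\<not> (\<exists>n\<le>k. (u, v) \<in> arcs_ends G ^^ n)"
  shows "\<not> graph_diam G \<le> enat k"
  using assms unfolding graph_diam_le_iff by blast

lemma enat_eq_Suc_if_le:
  assumes "d \<le> enat (Suc k)" "\<not> d \<le> enat k"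
  shows "d = enat (Suc k)"
  using assms by (cases d) auto

lemma enat_eq_infinity_if_not_le:
  assumes "\<And>k. \<not> d \<le> enat k"
  shows "d = \<infinity>"
  using assms by (cases d) auto

lemma (in wf_digraph) graph_diam_eq_2:
  assumes near: "\<And>u v. \<lbrakk>u \<in> verts G; v \<in> verts G; u \<noteq> v; (u, v) \<notin> arcs_ends G\<rbrakk>
      \<Longrightarrow> \<exists>w. (u, w) \<in> arcs_ends G \<and> (w, v) \<in> arcs_ends G"
    and far: "a \<in> verts G" "b \<in> verts G" "a \<noteq> b" "(a, b) \<notin> arcs_ends G"
  shows "graph_diam G = 2"
proof -
  have "\<exists>n\<le>Suc 1. (u, v) \<in> arcs_ends G ^^ n" if uv: "u \<in> verts G" "v \<in> verts G" for u v
  proof -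
    consider "u = v" | "(u, v) \<in> arcs_ends G"
      | w where "(u, w) \<in> arcs_ends G" "(w, v) \<in> arcs_ends G"
      using near[OF uv] by blast
    then show ?thesis
    proof cases
      case 1
      then show ?thesis by (intro exI[of _ 0]) simp
    next
      case 2
      then show ?thesis by (intro exI[of _ 1]) simp
    next
      case 3
      then show ?thesis by (intro exI[of _ 2]) (auto simp: numeral_2_eq_2)
    qed
  qed
  then have "graph_diam G \<le> enat (Suc 1)"
    using far(1) unfolding graph_diam_le_iff by blast
  moreover have "\<not> (\<exists>n\<le>1. (a, b) \<in> arcs_ends G ^^ n)"
  proof
    assume "\<exists>n\<le>1. (a, b) \<in> arcs_ends G ^^ n"
    then obtain n where "n = 0 \<or> n = 1" "(a, b) \<in> arcs_ends G ^^ n"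
      by (auto simp: le_Suc_eq)
    with far show False by (elim disjE) simp_all
  qed
  then have "\<not> graph_diam G \<le> enat 1" by (rule not_graph_diam_le[OF far(1,2)])
  ultimately have "graph_diam G = enat (Suc 1)" by (rule enat_eq_Suc_if_le)
  then show ?thesis by (simp add: numeral_eq_enat)
qed

section \<open>Comparability graphs\<close>

text \<open>
  The comparability graph of a map \<open>f\<close> into an order joins distinct vertices whose \<open>f\<close>-values are
  comparable; the strict one requires the values to differ.  For \<open>f x = \<langle>x\<rangle>\<close> these are the power
  graph and the reduced power graph.
\<close>

definition comparability_graph ::
    "('a \<Rightarrow> 'b::order) \<Rightarrow> 'a set \<Rightarrow> ('a, 'a \<times> 'a) pre_digraph" where
  "comparability_graph f V = with_proj
     \<lparr>pverts = V, parcs = {(u, v). u \<in> V \<and> v \<in> V \<and> u \<noteq> v \<and> (f v \<le> f u \<or> f u \<le> f v)}\<rparr>"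

definition strict_comparability_graph ::
    "('a \<Rightarrow> 'b::order) \<Rightarrow> 'a set \<Rightarrow> ('a, 'a \<times> 'a) pre_digraph" where
  "strict_comparability_graph f V = with_proj
     \<lparr>pverts = V, parcs = {(u, v). u \<in> V \<and> v \<in> V \<and> (f v < f u \<or> f u < f v)}\<rparr>"

lemma verts_comparability_graph [simp]: "verts (comparability_graph f V) = V"
  by (simp add: comparability_graph_def)

lemma verts_strict_comparability_graph [simp]: "verts (strict_comparability_graph f V) = V"
  by (simp add: strict_comparability_graph_def)

lemma arcs_ends_comparability_graph:
  "(u, v) \<in> arcs_ends (comparability_graph f V) \<longleftrightarrow>
     u \<in> V \<and> v \<in> V \<and> u \<noteq> v \<and> (f v \<le> f u \<or> f u \<le> f v)"
  by (simp add: comparability_graph_def)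

lemma arcs_ends_strict_comparability_graph:
  "(u, v) \<in> arcs_ends (strict_comparability_graph f V) \<longleftrightarrow>
     u \<in> V \<and> v \<in> V \<and> (f v < f u \<or> f u < f v)"
  by (simp add: strict_comparability_graph_def)

lemma wf_comparability_graph: "wf_digraph (comparability_graph f V)"
  by unfold_locales (auto simp: comparability_graph_def)

lemma wf_strict_comparability_graph: "wf_digraph (strict_comparability_graph f V)"
  by unfold_locales (auto simp: strict_comparability_graph_def)

lemma walk_avoiding_twins:
  assumes "(u, v) \<in> arcs_ends (comparability_graph f V) ^^ n"
  shows "f u = f v \<or> (\<exists>m\<le>n. (u, v) \<in> arcs_ends (strict_comparability_graph f V) ^^ m)"
  using assms
proof (induction n arbitrary: v)
  case 0
  then show ?case by simp
next
  case (Suc n)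
  let ?S = "arcs_ends (strict_comparability_graph f V)"
  note S = arcs_ends_strict_comparability_graph
  obtain w where uw: "(u, w) \<in> arcs_ends (comparability_graph f V) ^^ n"
    and wv: "(w, v) \<in> arcs_ends (comparability_graph f V)"
    using Suc.prems by auto
  have V: "u \<in> V" "w \<in> V" "v \<in> V"
  proof -
    show "w \<in> V" "v \<in> V" using wv by (auto simp: arcs_ends_comparability_graph)
    then show "u \<in> V"
      using uw by (cases n) (simp, metis relpow_Suc_D2 arcs_ends_comparability_graph)
  qed
  have step: "f w = f v \<or> (w, v) \<in> ?S"
    using wv by (auto simp: S arcs_ends_comparability_graph)
  from Suc.IH[OF uw] show ?case
  proof
    assume twins: "f u = f w"
    from step show ?thesis
    proof
      assume "(w, v) \<in> ?S"
      then have "(u, v) \<in> ?S ^^ 1" using twins V by (simp add: S)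
      then show ?thesis by (intro disjI2 exI[of _ 1]) simp
    qed (use twins in simp)
  next
    assume "\<exists>m\<le>n. (u, w) \<in> ?S ^^ m"
    then obtain m where m: "m \<le> n" "(u, w) \<in> ?S ^^ m" by blast
    from step show ?thesis
    proof
      assume twins: "f w = f v"
      show ?thesis
      proof (cases m)
        case 0
        then show ?thesis using m twins by simp
      next
        case (Suc l)
        then obtain y where "(u, y) \<in> ?S ^^ l" "(y, w) \<in> ?S"
          using m by auto
        moreover have "(y, v) \<in> ?S" using \<open>(y, w) \<in> ?S\<close> twins V by (simp add: S)
        ultimately have "(u, v) \<in> ?S ^^ m" using Suc by auto
        then show ?thesis using m le_SucI by blast
      qed
    next
      assume "(w, v) \<in> ?S"
      then have "(u, v) \<in> ?S ^^ Suc m" using m by auto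
      then show ?thesis using m by blast
    qed
  qed
qed

lemma graph_diam_strict_comparability_graph:
  assumes ab: "a \<in> V" "b \<in> V" "\<not> f a \<le> f b" "\<not> f b \<le> f a"
  shows "graph_diam (strict_comparability_graph f V) = graph_diam (comparability_graph f V)"
proof -
  let ?S = "arcs_ends (strict_comparability_graph f V)"
  let ?C = "arcs_ends (comparability_graph f V)"
  note S = arcs_ends_strict_comparability_graph
  note C = arcs_ends_comparability_graph
  interpret S: wf_digraph "strict_comparability_graph f V" by (rule wf_strict_comparability_graph)
  interpret C: wf_digraph "comparability_graph f V" by (rule wf_comparability_graph)
  have "?S \<subseteq> ?C" by (auto simp: S C)
  then have mono: "?S ^^ n \<subseteq> ?C ^^ n" for n by (induction n) auto
  have "graph_diam (strict_comparability_graph f V) \<le> enat k \<longleftrightarrow>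
      graph_diam (comparability_graph f V) \<le> enat k" for k
  proof
    assume "graph_diam (strict_comparability_graph f V) \<le> enat k"
    then show "graph_diam (comparability_graph f V) \<le> enat k"
      unfolding S.graph_diam_le_iff C.graph_diam_le_iff using mono by simp blast
  next
    assume "graph_diam (comparability_graph f V) \<le> enat k"
    then have walk: "\<exists>n\<le>k. (u, v) \<in> ?C ^^ n" if "u \<in> V" "v \<in> V" for u v
      using that unfolding C.graph_diam_le_iff by simp
    have "k \<ge> 2"
    proof (rule ccontr)
      assume "\<not> k \<ge> 2"
      moreover obtain n where n: "n \<le> k" "(a, b) \<in> ?C ^^ n" using walk ab by blast
      ultimately have "n = 0 \<or> n = 1" by auto
      with n have "a = b \<or> (a, b) \<in> ?C" by (elim disjE) simp_all
      then show False using ab by (auto simp: C)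
    qed
    have "\<exists>n\<le>k. (u, v) \<in> ?S ^^ n" if uv: "u \<in> V" "v \<in> V" for u v
    proof (cases "f u = f v")
      case False
      then show ?thesis using walk[OF uv] walk_avoiding_twins by (meson order_trans)
    next
      case True
      \<comment> \<open>The value at \<open>u\<close> cannot equal both incomparable values, so \<open>u\<close> has a walk to
        \<open>a\<close> or \<open>b\<close> whose first step leaves the twins of \<open>u\<close>.\<close>
      obtain c where c: "c \<in> V" "f u \<noteq> f c" using ab by (metis order_refl)
      obtain m where m: "(u, c) \<in> ?S ^^ m"
        using walk[OF uv(1) c(1)] walk_avoiding_twins c(2) by meson
      then obtain w where "(u, w) \<in> ?S"
        using c(2) by (cases m) (simp, metis relpow_Suc_D2)
      moreover from this have "(w, v) \<in> ?S" using True uv by (auto simp: S)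
      ultimately have "(u, v) \<in> ?S ^^ 2" by (auto simp: numeral_2_eq_2)
      then show ?thesis using \<open>k \<ge> 2\<close> by blast
    qed
    then show "graph_diam (strict_comparability_graph f V) \<le> enat k"
      unfolding S.graph_diam_le_iff using ab by auto
  qed
  then show ?thesis
    by (metis dual_order.antisym enat_ile nle_le not_infinity_eq)
qed

text \<open>On no vertices, both graphs are disconnected.\<close>

lemma graph_diam_comparability_graph_empty:
  "graph_diam (strict_comparability_graph f {}) = \<infinity>"
  "graph_diam (comparability_graph f {}) = \<infinity>"
  by (simp_all add: graph_diam_def connected_conv)

lemma reduced_power_graph_eq:
  "reduced_power_graph G = strict_comparability_graph (\<lambda>x. generate G {x}) (carrier G)"
  by (simp add: reduced_power_graph_def strict_comparability_graph_def)

lemma proper_reduced_power_graph_eq: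
  "proper_reduced_power_graph G =
     strict_comparability_graph (\<lambda>x. generate G {x}) (carrier G - {\<one>\<^bsub>G\<^esub>})"
  by (auto simp: proper_reduced_power_graph_def induce_subgraph_def reduced_power_graph_def
      strict_comparability_graph_def with_proj_def)

lemma proper_power_graph_eq:
  "proper_power_graph G =
     comparability_graph (\<lambda>x. generate G {x}) (carrier G - {\<one>\<^bsub>G\<^esub>})"
  by (simp add: proper_power_graph_def comparability_graph_def)

section \<open>Finite cyclic groups\<close>

lemma cyclic_group_integer_mod_group: "cyclic_group (integer_mod_group n)"
proof (cases "n = 1")
  case True
  then show ?thesis by (simp add: trivial_imp_cyclic_group trivial_integer_mod_group)
next
  case False
  interpret Z: group "integer_mod_group n" by simp
  have one: "1 \<in> carrier (integer_mod_group n)" using False by simp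
  have "carrier (integer_mod_group n) \<subseteq> range (\<lambda>k::int. 1 [^]\<^bsub>integer_mod_group n\<^esub> k)"
  proof
    fix x assume "x \<in> carrier (integer_mod_group n)"
    then have "x = x mod int n" by (auto simp: carrier_integer_mod_group split: if_splits)
    then show "x \<in> range (\<lambda>k::int. 1 [^]\<^bsub>integer_mod_group n\<^esub> k)"
      by (simp add: int_pow_integer_mod_group image_iff) metis
  qed
  moreover have "range (\<lambda>k::int. 1 [^]\<^bsub>integer_mod_group n\<^esub> k) \<subseteq> carrier (integer_mod_group n)"
    using Z.int_pow_closed[OF one] by blast
  ultimately show ?thesis using one unfolding Z.cyclic_group by blast
qed

context group
begin

lemma cyclic_group_iff_generate: "cyclic_group G \<longleftrightarrow> (\<exists>g\<in>carrier G. generate G {g} = carrier G)"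
  unfolding cyclic_group by (auto simp: generate_pow full_SetCompr_eq)

lemma iso_integer_mod_group_iff:
  assumes "finite (carrier G)"
  shows "G \<cong> integer_mod_group n \<longleftrightarrow> cyclic_group G \<and> order G = n"
proof
  assume iso: "G \<cong> integer_mod_group n"
  have "n \<noteq> 0"
  proof
    assume "n = 0"
    then show False
      using iso_finite[OF iso] assms by (simp add: carrier_integer_mod_group infinite_UNIV_int)
  qed
  then show "cyclic_group G \<and> order G = n"
    using iso_same_card[OF iso] isomorphic_group_cyclicity[OF iso]
    by (simp add: order_def carrier_integer_mod_group cyclic_group_integer_mod_group)
next
  assume "cyclic_group G \<and> order G = n"
  then obtain g where g: "g \<in> carrier G" "carrier G = range (\<lambda>k::int. g [^] k)"
    and n: "order G = n" by (auto simp: cyclic_group)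
  have "n > 0" using n assms order_gt_0_iff_finite by blast
  have Z: "carrier (integer_mod_group n) = {0..<int n}"
    using \<open>n > 0\<close> by (simp add: carrier_integer_mod_group)
  have mod: "g [^] (k mod int n) = g [^] k" for k :: int
  proof -
    have "g [^] (int n) = \<one>" using pow_order_eq_1[OF g(1)] n by (simp add: int_pow_int)
    then have "g [^] (int n * (k div int n)) = \<one>"
      using g(1) by (simp add: int_pow_pow[symmetric])
    then have "g [^] (int n * (k div int n) + k mod int n) = g [^] (k mod int n)"
      using g(1) by (simp only: int_pow_mult) simp
    then show ?thesis by simp
  qed
  let ?h = "\<lambda>k::int. g [^] k"
  have "?h \<in> hom (integer_mod_group n) G"
    by (rule homI) (use g(1) in \<open>auto simp: mod int_pow_mult\<close>)
  moreover have "bij_betw ?h (carrier (integer_mod_group n)) (carrier G)"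
  proof -
    have "carrier G \<subseteq> ?h ` {0..<int n}"
    proof
      fix x assume "x \<in> carrier G"
      then obtain k :: int where "x = g [^] k" using g(2) by auto
      then have "x = ?h (k mod int n)" by (simp add: mod)
      then show "x \<in> ?h ` {0..<int n}" using \<open>n > 0\<close> by simp
    qed
    then have img: "?h ` {0..<int n} = carrier G" using g(1) by auto
    then have "inj_on ?h {0..<int n}"
      by (intro eq_card_imp_inj_on) (use n in \<open>simp_all add: order_def\<close>)
    with img show ?thesis by (simp add: bij_betw_def Z)
  qed
  ultimately have "integer_mod_group n \<cong> G" by (auto simp: is_iso_def iso_def)
  then show "G \<cong> integer_mod_group n" by (rule group.iso_sym[OF group_integer_mod_group])
qed

lemma generate_singleton_subset_iff:
  assumes "x \<in> carrier G" "y \<in> carrier G"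
  shows "generate G {x} \<subseteq> generate G {y} \<longleftrightarrow> x \<in> generate G {y}"
proof
  assume "generate G {x} \<subseteq> generate G {y}"
  then show "x \<in> generate G {y}" using generate.incl[of x "{x}" G] by blast
next
  assume "x \<in> generate G {y}"
  then show "generate G {x} \<subseteq> generate G {y}"
    using generate_subgroup_incl[of "{x}"] generate_is_subgroup[of "{y}"] assms by blast
qed

lemma generate_inv:
  assumes "x \<in> carrier G"
  shows "generate G {inv x} = generate G {x}"
proof -
  have "inv y \<in> generate G {y}" for y by (rule generate.inv) simp
  from this[of x] this[of "inv x"]
  have "inv x \<in> generate G {x}" "x \<in> generate G {inv x}" using assms by simp_all
  then show ?thesis
    using assms generate_singleton_subset_iff[of x "inv x"]
      generate_singleton_subset_iff[of "inv x" x] by simp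
qed

lemma generate_singleton_eq_one_iff:
  assumes "x \<in> carrier G"
  shows "generate G {x} = {\<one>} \<longleftrightarrow> x = \<one>"
  using generate.incl[of x "{x}" G] generate_one by auto

lemma generate_one_psubset:
  assumes "x \<in> carrier G" "x \<noteq> \<one>"
  shows "generate G {\<one>} \<subset> generate G {x}"
  using assms generate_singleton_eq_one_iff[of x] generate.one[of G "{x}"]
  by (auto simp: generate_one)

lemma generate_eq_if_inv_self:
  assumes "x \<in> carrier G" "inv x = x"
  shows "generate G {x} = {\<one>, x}"
proof
  have "x \<otimes> x = \<one>" using assms r_inv by metis
  then have "subgroup {\<one>, x} G"
    using assms by (intro subgroupI) auto
  then show "generate G {x} \<subseteq> {\<one>, x}" by (intro generate_subgroup_incl) auto
  show "{\<one>, x} \<subseteq> generate G {x}" by (auto intro: generate.intros)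
qed

lemma generate_prime_order:
  assumes "prime (order G)" "x \<in> carrier G" "x \<noteq> \<one>"
  shows "generate G {x} = carrier G"
proof -
  have fin: "finite (carrier G)"
    using prime_gt_0_nat[OF assms(1)] order_gt_0_iff_finite by simp
  have "ord x dvd order G" using assms by (simp add: ord_dvd_group_order)
  moreover have "ord x \<noteq> 1" using ord_eq_1[OF assms(2)] assms(3) by blast
  ultimately have "ord x = order G" using assms(1) by (auto simp: prime_nat_iff)
  then have "card (generate G {x}) = card (carrier G)"
    using generate_pow_card assms by (simp add: order_def)
  then show ?thesis
    using fin generate_incl[of "{x}"] assms by (intro card_subset_eq) auto
qed

lemma prime_order_imp_cyclic:
  assumes "prime (order G)"
  shows "cyclic_group G"
proof -
  have "order G \<noteq> 1" using assms by auto
  then have "carrier G \<noteq> {\<one>}" by (auto simp: order_def)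
  then obtain x where "x \<in> carrier G" "x \<noteq> \<one>" using one_closed by blast
  then show ?thesis using generate_prime_order[OF assms] cyclic_group_iff_generate by blast
qed

lemma generator_ne_inv:
  assumes "g \<in> carrier G" "generate G {g} = carrier G" "order G > 2"
  shows "inv g \<noteq> g"
proof
  assume "inv g = g"
  then have "carrier G = {\<one>, g}" using assms generate_eq_if_inv_self by simp
  then have "order G \<le> 2" by (simp add: order_def card_insert_if)
  with assms show False by simp
qed

lemma comparable_imp_cyclic_prime_power:
  assumes fin: "finite (carrier G)" and "order G \<noteq> 1"
    and comparable: "\<And>x y. \<lbrakk>x \<in> carrier G; y \<in> carrier G\<rbrakk> \<Longrightarrow>
      generate G {x} \<subseteq> generate G {y} \<or> generate G {y} \<subseteq> generate G {x}"
  shows "cyclic_group G \<and> (\<exists>(p::nat) n. prime p \<and> n \<ge> 1 \<and> order G = p ^ n)"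
proof -
  have fin_gen: "finite (generate G {x})" if "x \<in> carrier G" for x
    using fin generate_incl[of "{x}"] that by (auto intro: finite_subset)
  obtain g where g: "g \<in> carrier G" and max: "\<And>x. x \<in> carrier G \<Longrightarrow> ord x \<le> ord g"
  proof -
    have "Max (ord ` carrier G) \<in> ord ` carrier G" using fin by (intro Max_in) auto
    then obtain g where "g \<in> carrier G" "ord g = Max (ord ` carrier G)" by auto
    with that fin show thesis by simp
  qed
  have "carrier G \<subseteq> generate G {g}"
  proof
    fix x assume x: "x \<in> carrier G"
    from comparable[OF x g] show "x \<in> generate G {g}"
    proof
      assume "generate G {x} \<subseteq> generate G {g}"
      then show ?thesis using x g by (simp add: generate_singleton_subset_iff)
    next
      assume "generate G {g} \<subseteq> generate G {x}"
      then have "generate G {g} = generate G {x}"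
        using max[OF x] x g fin_gen by (intro card_seteq) (auto simp: generate_pow_card)
      then show ?thesis using x g generate_singleton_subset_iff by blast
    qed
  qed
  then have gen: "generate G {g} = carrier G" using generate_incl[of "{g}"] g by blast
  then have ord_g: "ord g = order G" using g by (simp add: generate_pow_card order_def)
  have "order G \<noteq> 0" using fin order_gt_0_iff_finite by auto
  obtain p where p: "prime p" "p dvd order G"
    using \<open>order G \<noteq> 1\<close> prime_factor_nat by blast
  obtain m where "order G = p ^ multiplicity p (order G) * m" and not_dvd: "\<not> p dvd m"
    using multiplicity_decompose'[of "order G" p] \<open>order G \<noteq> 0\<close> p(1) not_prime_unit by metis
  moreover define k where "k = multiplicity p (order G)"
  ultimately have order: "order G = p ^ k * m" by simp
  have "k \<ge> 1"
    using p \<open>order G \<noteq> 0\<close> unfolding k_def by (simp add: prime_multiplicity_gt_zero_iff Suc_le_eq)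
  have "m \<noteq> 0" using not_dvd by (metis dvd_0_right)
  have cop: "coprime (p ^ k) m"
    using not_dvd p by (simp add: prime_imp_coprime)
  \<comment> \<open>The powers \<open>g [^] m\<close> and \<open>g [^] (p ^ k)\<close> have coprime orders; being comparable, one of
    them has order 1, and this is not the first.\<close>
  have ord_m: "ord (g [^] m) = p ^ k"
    using ord_pow[OF g, of m] ord_g order \<open>m \<noteq> 0\<close> by simp
  have ord_k: "ord (g [^] (p ^ k)) = m"
    using ord_pow[OF g, of "p ^ k"] ord_g order p by simp
  have dvd: "ord x dvd ord y"
    if xy: "x \<in> carrier G" "y \<in> carrier G" "generate G {x} \<subseteq> generate G {y}" for x y
  proof -
    have "x \<in> generate G {y}" using xy by (simp add: generate_singleton_subset_iff)
    then obtain i :: nat where "x = y [^] i"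
      using generate_pow_on_finite_carrier[OF fin xy(2)] by auto
    then have "x [^] ord y = (y [^] ord y) [^] i"
      using xy(2) by (simp only: nat_pow_pow mult.commute)
    then show ?thesis using xy by (simp add: pow_eq_id)
  qed
  have "p ^ k dvd m \<or> m dvd p ^ k"
    using comparable[of "g [^] m" "g [^] (p ^ k)"] dvd g ord_m ord_k by (metis nat_pow_closed)
  then have "m = 1"
  proof
    assume "p ^ k dvd m"
    then have "p dvd m" using \<open>k \<ge> 1\<close> by (meson dvd_power dvd_trans less_le_trans zero_less_one)
    with not_dvd show ?thesis by simp
  next
    assume "m dvd p ^ k"
    then show ?thesis using cop by (metis coprime_common_divisor_nat dvd_refl)
  qed
  then have "order G = p ^ k" using order by simp
  moreover have "cyclic_group G" using gen g cyclic_group_iff_generate by blast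
  ultimately show ?thesis using p \<open>k \<ge> 1\<close> by blast
qed

section \<open>Diameters of reduced power graphs\<close>

lemma order_2_imp_carrier:
  assumes "order G = 2"
  obtains x where "x \<noteq> \<one>" "carrier G = {\<one>, x}"
proof -
  from assms obtain a b where "carrier G = {a, b}" "a \<noteq> b"
    by (auto simp: order_def card_2_iff)
  then show thesis using that one_closed by (metis insert_commute insert_iff singletonD)
qed

lemma graph_diam_reduced_power_graph_order_2:
  assumes "order G = 2"
  shows "graph_diam (reduced_power_graph G) = 1"
proof -
  obtain x where x: "x \<noteq> \<one>" "carrier G = {\<one>, x}" using assms by (rule order_2_imp_carrier)
  let ?H = "strict_comparability_graph (\<lambda>x. generate G {x}) (carrier G)"
  interpret H: wf_digraph ?H by (rule wf_strict_comparability_graph)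
  have "generate G {\<one>} \<subset> generate G {x}" using x by (intro generate_one_psubset) auto
  then have adj: "(\<one>, x) \<in> arcs_ends ?H" "(x, \<one>) \<in> arcs_ends ?H"
    using x by (auto simp: arcs_ends_strict_comparability_graph)
  have "\<exists>n\<le>Suc 0. (u, v) \<in> arcs_ends ?H ^^ n" if "u \<in> carrier G" "v \<in> carrier G" for u v
  proof (cases "u = v")
    case True
    then show ?thesis by (intro exI[of _ 0]) simp
  next
    case False
    then have "(u, v) \<in> arcs_ends ?H" using adj that x(2) by auto
    then show ?thesis by (intro exI[of _ 1]) simp
  qed
  then have "graph_diam ?H \<le> enat (Suc 0)"
    unfolding H.graph_diam_le_iff by auto
  moreover have "\<not> graph_diam ?H \<le> enat 0"
    using x by (intro H.not_graph_diam_le[of \<one> x]) auto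
  ultimately have "graph_diam ?H = enat (Suc 0)" by (rule enat_eq_Suc_if_le)
  then show ?thesis by (simp add: reduced_power_graph_eq one_enat_def)
qed

lemma graph_diam_reduced_power_graph:
  assumes "finite (carrier G)" "order G > 2"
  shows "graph_diam (reduced_power_graph G) = 2"
proof -
  let ?H = "strict_comparability_graph (\<lambda>x. generate G {x}) (carrier G)"
  interpret H: wf_digraph ?H by (rule wf_strict_comparability_graph)
  \<comment> \<open>Two distinct non-adjacent vertices: an element and its inverse or, if every element
    is its own inverse, two distinct involutions.\<close>
  obtain a b where ab: "a \<in> carrier G" "b \<in> carrier G" "a \<noteq> b"
    "\<not> generate G {a} \<subset> generate G {b}" "\<not> generate G {b} \<subset> generate G {a}"
  proof (cases "\<exists>x\<in>carrier G. inv x \<noteq> x")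
    case True
    then obtain x where "x \<in> carrier G" "inv x \<noteq> x" by blast
    then show thesis by (intro that[of "inv x" x]) (auto simp: generate_inv)
  next
    case False
    have "\<not> carrier G \<subseteq> {\<one>, x}" for x
    proof
      assume "carrier G \<subseteq> {\<one>, x}"
      then have "order G \<le> card {\<one>, x}" unfolding order_def by (intro card_mono) auto
      also have "\<dots> \<le> 2" by (simp add: card_insert_if)
      finally show False using assms by simp
    qed
    then obtain x y where "x \<in> carrier G" "x \<noteq> \<one>" "y \<in> carrier G" "y \<noteq> \<one>" "y \<noteq> x"
      by (metis insertI1 insertI2 subsetI)
    with False show thesis by (intro that[of x y]) (auto simp: generate_eq_if_inv_self)
  qed
  have hub: "(\<one>, x) \<in> arcs_ends ?H" "(x, \<one>) \<in> arcs_ends ?H"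
    if "x \<in> carrier G" "x \<noteq> \<one>" for x
    using generate_one_psubset[OF that] that by (auto simp: arcs_ends_strict_comparability_graph)
  have "graph_diam ?H = 2"
  proof (rule H.graph_diam_eq_2[of a b])
    fix u v
    assume uv: "u \<in> verts ?H" "v \<in> verts ?H" "u \<noteq> v" "(u, v) \<notin> arcs_ends ?H"
    then have "u \<noteq> \<one>" "v \<noteq> \<one>" using hub by auto
    then show "\<exists>w. (u, w) \<in> arcs_ends ?H \<and> (w, v) \<in> arcs_ends ?H"
      using hub uv by auto
  qed (use ab in \<open>auto simp: arcs_ends_strict_comparability_graph\<close>)
  then show ?thesis by (simp add: reduced_power_graph_eq)
qed

lemma graph_diam_proper_reduced_power_graph_cyclic_composite:
  assumes fin: "finite (carrier G)" and "cyclic_group G"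
    and d: "d dvd order G" "d \<noteq> 1" "d \<noteq> order G"
  shows "graph_diam (proper_reduced_power_graph G) = 2"
proof -
  let ?V = "carrier G - {\<one>}"
  let ?H = "strict_comparability_graph (\<lambda>x. generate G {x}) ?V"
  interpret H: wf_digraph ?H by (rule wf_strict_comparability_graph)
  obtain g where g: "g \<in> carrier G" "generate G {g} = carrier G"
    using \<open>cyclic_group G\<close> cyclic_group_iff_generate by blast
  have ord_g: "ord g = order G" using g by (simp add: generate_pow_card order_def)
  have "order G > 0" using fin order_gt_0_iff_finite by blast
  with d have "d > 0" by (auto intro: Nat.gr0I)
  have "d < order G" using d \<open>order G > 0\<close> by (simp add: dvd_imp_le le_neq_implies_less)
  then have "order G > 2" using d \<open>d > 0\<close> by simp
  \<comment> \<open>The element \<open>h\<close> has order \<open>order G div d\<close>, so it is neither the identity nor a generator.\<close>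
  define h where "h = g [^] d"
  have h: "h \<in> carrier G" using g by (simp add: h_def)
  have ord_h: "ord h = order G div d"
    using ord_pow[OF g(1), of d] d ord_g \<open>d > 0\<close> by (simp add: h_def)
  have "h \<noteq> \<one>"
    using ord_h d \<open>d > 0\<close> h by (metis dvd_div_mult_self mult_1 ord_eq_1)
  have "order G div d < order G" using d \<open>d > 0\<close> \<open>order G > 0\<close> by (intro div_less_dividend) auto
  then have nongen_h: "generate G {h} \<noteq> carrier G"
    using ord_h h by (metis generate_pow_card nless_le order_def)
  have sub: "generate G {x} \<subseteq> carrier G" if "x \<in> carrier G" for x
    using generate_incl[of "{x}"] that by simp
  have "g \<noteq> \<one>" using g \<open>h \<noteq> \<one>\<close> by (auto simp: h_def)
  have adj: "(x, y) \<in> arcs_ends ?H" "(y, x) \<in> arcs_ends ?H"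
    if "x \<in> ?V" "y \<in> ?V" "generate G {x} = carrier G" "generate G {y} \<noteq> carrier G" for x y
    using that sub[of y] by (auto simp: arcs_ends_strict_comparability_graph)
  have "graph_diam ?H = 2"
  proof (rule H.graph_diam_eq_2[of "inv g" g])
    show "inv g \<in> verts ?H" "g \<in> verts ?H" "inv g \<noteq> g" "(inv g, g) \<notin> arcs_ends ?H"
      using g \<open>g \<noteq> \<one>\<close> generator_ne_inv[OF g \<open>order G > 2\<close>]
      by (auto simp: arcs_ends_strict_comparability_graph generate_inv inv_eq_1_iff)
  next
    fix u v
    assume uv: "u \<in> verts ?H" "v \<in> verts ?H" "(u, v) \<notin> arcs_ends ?H"
    then have V: "u \<in> ?V" "v \<in> ?V" "g \<in> ?V" "h \<in> ?V"
      using g \<open>g \<noteq> \<one>\<close> h \<open>h \<noteq> \<one>\<close> by auto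
    have same: "generate G {u} = carrier G \<longleftrightarrow> generate G {v} = carrier G"
      using uv(3) adj(1)[OF V(1,2)] adj(2)[OF V(2,1)] by blast
    show "\<exists>w. (u, w) \<in> arcs_ends ?H \<and> (w, v) \<in> arcs_ends ?H"
    proof (cases "generate G {u} = carrier G")
      case True
      then have "(u, h) \<in> arcs_ends ?H" "(h, v) \<in> arcs_ends ?H"
        using same adj V nongen_h by simp_all
      then show ?thesis by blast
    next
      case False
      then have "(u, g) \<in> arcs_ends ?H" "(g, v) \<in> arcs_ends ?H"
        using same adj V g(2) by simp_all
      then show ?thesis by blast
    qed
  qed
  then show ?thesis by (simp add: proper_reduced_power_graph_eq)
qed

lemma graph_diam_proper_reduced_power_graph_prime_order:
  assumes "prime (order G)" "order G \<noteq> 2"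
  shows "graph_diam (proper_reduced_power_graph G) = \<infinity>"
proof -
  let ?V = "carrier G - {\<one>}"
  let ?H = "strict_comparability_graph (\<lambda>x. generate G {x}) ?V"
  interpret H: wf_digraph ?H by (rule wf_strict_comparability_graph)
  obtain g where g: "g \<in> carrier G" "generate G {g} = carrier G"
    using prime_order_imp_cyclic[OF assms(1)] cyclic_group_iff_generate by blast
  have "order G > 2" using assms prime_ge_2_nat[of "order G"] by simp
  then have "inv g \<noteq> g" using g generator_ne_inv by blast
  then have V: "inv g \<in> ?V" "g \<in> ?V" using g by (auto simp: inv_eq_1_iff)
  have "arcs_ends ?H = {}"
    using generate_prime_order[OF assms(1)]
    by (auto simp: arcs_ends_strict_comparability_graph)
  then have "(inv g, g) \<notin> arcs_ends ?H ^^ n" for n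
    using \<open>inv g \<noteq> g\<close> by (cases n) auto
  then have "graph_diam ?H = \<infinity>"
    using V by (intro enat_eq_infinity_if_not_le H.not_graph_diam_le[of "inv g" g]) simp_all
  then show ?thesis by (simp add: proper_reduced_power_graph_eq)
qed

lemma graph_diam_proper_reduced_power_graph:
  assumes fin: "finite (carrier G)"
    and not_prime_power: "\<And>(p::nat) n. \<lbrakk>cyclic_group G; prime p; n \<ge> 1\<rbrakk> \<Longrightarrow> order G \<noteq> p ^ n"
  shows "graph_diam (proper_reduced_power_graph G) = graph_diam (proper_power_graph G)"
proof (cases "order G = 1")
  case True
  then obtain x where "carrier G = {x}" by (auto simp: order_def card_1_singleton_iff)
  then have empty: "carrier G - {\<one>} = {}" using one_closed by auto
  show ?thesis
    unfolding proper_reduced_power_graph_eq proper_power_graph_eq empty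
    by (simp add: graph_diam_comparability_graph_empty)
next
  case False
  then obtain a b where ab: "a \<in> carrier G" "b \<in> carrier G"
    "\<not> generate G {a} \<subseteq> generate G {b}" "\<not> generate G {b} \<subseteq> generate G {a}"
    using comparable_imp_cyclic_prime_power[OF fin] not_prime_power by blast
  moreover have "generate G {\<one>} \<subseteq> generate G {x}" for x
    by (auto simp: generate_one intro: generate.one)
  ultimately have "a \<in> carrier G - {\<one>}" "b \<in> carrier G - {\<one>}" by auto
  then show ?thesis
    unfolding proper_reduced_power_graph_eq proper_power_graph_eq
    using ab by (intro graph_diam_strict_comparability_graph[of a _ b]) auto
qed

end

theorem theorem6p2:
  fixes G :: "('a, 'm) monoid_scheme"
  assumes "group G" and "finite (carrier G)"
  shows
    "(order G \<noteq> 1 \<longrightarrow>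
        graph_diam (reduced_power_graph G) =
          (if G \<cong> integer_mod_group 2 then 1 else 2)) \<and>
     (\<not> G \<cong> integer_mod_group 2 \<longrightarrow>
        graph_diam (proper_reduced_power_graph G) =
          (if \<exists>(p::nat) (n::nat). prime p \<and> n \<ge> 2 \<and> G \<cong> integer_mod_group (p ^ n) then 2
           else if \<exists>p::nat. prime p \<and> G \<cong> integer_mod_group p then \<infinity>
           else graph_diam (proper_power_graph G)))"
proof -
  interpret group G by (rule assms(1))
  note fin = assms(2)
  note iso_iff = iso_integer_mod_group_iff[OF fin]
  have iso_prime_iff: "G \<cong> integer_mod_group p \<longleftrightarrow> order G = p" if "prime p" for p
    using that prime_order_imp_cyclic by (auto simp: iso_iff)
  have "order G > 0" using fin order_gt_0_iff_finite by blast
  have "graph_diam (reduced_power_graph G) = (if G \<cong> integer_mod_group 2 then 1 else 2)"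
    if "order G \<noteq> 1"
    using that \<open>order G > 0\<close> graph_diam_reduced_power_graph_order_2
      graph_diam_reduced_power_graph[OF fin] iso_prime_iff[OF two_is_prime_nat]
    by (cases "order G = 2") auto
  moreover have "graph_diam (proper_reduced_power_graph G) =
      (if \<exists>(p::nat) (n::nat). prime p \<and> n \<ge> 2 \<and> G \<cong> integer_mod_group (p ^ n) then 2
       else if \<exists>p::nat. prime p \<and> G \<cong> integer_mod_group p then \<infinity>
       else graph_diam (proper_power_graph G))"
    (is "_ = (if ?A then _ else if ?B then _ else _)")
    if not2: "\<not> G \<cong> integer_mod_group 2"
  proof -
    consider ?A | "\<not> ?A" ?B | "\<not> ?A" "\<not> ?B" by blast
    then show ?thesis
    proof cases
      case 1
      then obtain p n :: nat where p: "prime p" and n: "n \<ge> 2"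
        and G: "cyclic_group G" "order G = p ^ n"
        by (auto simp: iso_iff)
      have "p dvd order G" "p \<noteq> 1" "p \<noteq> order G"
        using p n G prime_gt_1_nat[OF p] power_strict_increasing[of 1 n p] by auto
      then show ?thesis
        using graph_diam_proper_reduced_power_graph_cyclic_composite[OF fin G(1)] 1 by simp
    next
      case 2
      then have "prime (order G)" using iso_prime_iff by auto
      moreover have "order G \<noteq> 2" using not2 iso_prime_iff[OF two_is_prime_nat] by simp
      ultimately show ?thesis
        using graph_diam_proper_reduced_power_graph_prime_order 2 by simp
    next
      case 3
      have "order G \<noteq> p ^ n" if "cyclic_group G" "prime p" "n \<ge> 1" for p n
      proof
        assume "order G = p ^ n"
        then have iso: "G \<cong> integer_mod_group (p ^ n)" using that by (simp add: iso_iff)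
        show False
        proof (cases "n = 1")
          case True
          then show False using 3(2) iso that by auto
        next
          case False
          then have "n \<ge> 2" using that by simp
          then show False using 3(1) iso that by blast
        qed
      qed
      then have "graph_diam (proper_reduced_power_graph G) = graph_diam (proper_power_graph G)"
        by (rule graph_diam_proper_reduced_power_graph[OF fin])
      then show ?thesis using 3 by (simp only: if_False)
    qed
  qed
  ultimately show ?thesis by blast
qed

end
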